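(* Let $k,n$ be positive integers and write $m=\lfloor n/2\rfloor$. If $k-m$ divides $m$, then $\textsc{bm}(k,n,n)\le\min(k,\lceil n/2\rceil)$.
   Context: A hypergraph is identified with its finite edge set; a matching is a set of pairwise disjoint edges. A hypergraph $H$ is $k$-partite with sides $V_1,\ldots,V_k$ (a fixed partition of its vertex set) if $|e\cap V_t|=1$ for every edge $e$ and every $t$. For $f:H\to\mathbb{R}_{\ge0}$, $\deg_f(v)=\sum_{e\ni v}f(e)$; $f$ is balanced if $\deg_f$ is constant on each side. $H$ is $(b_1,\ldots,b_k)$-fractionally balanced if it is $k$-partite with sides of sizes $b_1,\ldots,b_k$ and has a nonzero balanced $f:H\to\mathbb{R}_{\ge0}$. $\textsc{bm}(b_1,\ldots,b_k)$ is the largest $m$ such that every $(b_1,\ldots,b_k)$-fractionally balanced $k$-partite hypergraph has a matching of size $m$. *)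

theory Defs
  imports Complex_Main
begin

text \<open>A hypergraph is its finite edge set. The sides of a \<open>k\<close>-partite hypergraph are given as a
  list \<open>Vs\<close> of length \<open>k\<close>; they partition the vertex set, so all edges lie in their union.\<close>

definition matching :: "'a set set \<Rightarrow> bool" where
  "matching M \<longleftrightarrow> finite M \<and> pairwise disjnt M"

definition partite :: "'a set list \<Rightarrow> 'a set set \<Rightarrow> bool" where
  "partite Vs H \<longleftrightarrow>
     finite H \<and>
     (\<forall>V\<in>set Vs. finite V) \<and>
     (\<forall>i<length Vs. \<forall>j<length Vs. i \<noteq> j \<longrightarrow> disjnt (Vs ! i) (Vs ! j)) \<and>
     (\<forall>e\<in>H. e \<subseteq> \<Union>(set Vs) \<and> (\<forall>V\<in>set Vs. card (e \<inter> V) = 1))"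

definition fdeg :: "'a set set \<Rightarrow> ('a set \<Rightarrow> real) \<Rightarrow> 'a \<Rightarrow> real" where
  "fdeg H f v = (\<Sum>e | e \<in> H \<and> v \<in> e. f e)"

definition balanced :: "'a set list \<Rightarrow> 'a set set \<Rightarrow> ('a set \<Rightarrow> real) \<Rightarrow> bool" where
  "balanced Vs H f \<longleftrightarrow> (\<forall>V\<in>set Vs. \<forall>u\<in>V. \<forall>v\<in>V. fdeg H f u = fdeg H f v)"

definition fractionally_balanced :: "nat list \<Rightarrow> 'a set set \<Rightarrow> bool" where
  "fractionally_balanced bs H \<longleftrightarrow>
     (\<exists>Vs. partite Vs H \<and> map card Vs = bs \<and>
        (\<exists>f. (\<forall>e\<in>H. 0 \<le> f e) \<and> (\<exists>e\<in>H. f e \<noteq> 0) \<and> balanced Vs H f))"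

text \<open>Vertices are taken from \<^typ>\<open>nat\<close>, which loses no generality because the vertex sets are
  finite. The maximum exists whenever \<open>bs\<close> is a nonempty list of positive numbers, since then the
  complete \<open>k\<close>-partite hypergraph is fractionally balanced.\<close>

definition bm :: "nat list \<Rightarrow> nat" where
  "bm bs = (GREATEST m. \<forall>H :: nat set set. fractionally_balanced bs H \<longrightarrow>
              (\<exists>M\<subseteq>H. matching M \<and> card M = m))"

end

theory Submission
  imports Defs
begin

text \<open>Let \<open>m = \<lfloor>n / 2\<rfloor>\<close> and \<open>d = k - m\<close>. If \<open>k \<le> \<lceil>n / 2\<rceil>\<close>, the complete hypergraph suffices, as its
  matchings inject into the first side. Otherwise \<open>m = d q\<close>, and we cut the other two sides \<open>B\<close>
  and \<open>C\<close> into \<open>m\<close> blocks of two vertices each, leaving one spare vertex in each side when \<open>n\<close> is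
  odd. The first side consists of one vertex for each block and one vertex for each of the \<open>d\<close>
  groups of \<open>q\<close> consecutive blocks. The group vertex is joined to the two parallel pairs of every
  block of its group (weight \<open>d\<close>), the block vertex to the two crossing pairs of its block
  (weight \<open>m\<close>), and for odd \<open>n\<close> every vertex of the first side is joined to the spare pair
  (weight \<open>1\<close>). This weighting is balanced, and any two edges at the same block meet, so a matching
  has at most \<open>\<lceil>n / 2\<rceil>\<close> edges.\<close>

section \<open>Upper bounds on \<open>bm\<close> from a single hypergraph\<close>

lemma bm_le_if_fractionally_balanced:
  fixes H :: "nat set set"
  assumes H: "fractionally_balanced bs H"
    and le: "\<And>M. M \<subseteq> H \<Longrightarrow> matching M \<Longrightarrow> card M \<le> s"
  shows "bm bs \<le> s"
proof -
  let ?P = "\<lambda>m. \<forall>H :: nat set set. fractionally_balanced bs H \<longrightarrow>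
              (\<exists>M\<subseteq>H. matching M \<and> card M = m)"
  \<comment> \<open>\<open>GREATEST\<close> is sure to satisfy \<open>?P\<close> once
    \<open>?P\<close> is satisfiable and bounded: the empty matching settles size 0, and
    \<open>H\<close> bounds every admissible size by \<open>s\<close>.\<close>
  have "?P 0"
    by (auto simp: matching_def intro!: exI[of _ "{}"])
  moreover have bound: "m \<le> s" if "?P m" for m
    using that H le by blast
  ultimately have "?P (GREATEST m. ?P m)"
    by (rule GreatestI_nat[where P = ?P and k = 0 and b = s]) auto
  then show ?thesis
    unfolding bm_def by (rule bound)
qed

text \<open>Pigeonhole: \<open>g\<close> gives the edges \<open>s\<close> possible labels, and edges
  with equal labels meet, so a matching uses each label at most once. Natural weights on index
  triples turn the degrees of a concrete example into plain finite sums.\<close>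

lemma bm_three_sides_le:
  fixes w g :: "nat \<Rightarrow> nat \<Rightarrow> nat \<Rightarrow> nat"
  assumes "k > 0" and "\<alpha> > 0"
    and deg1: "\<And>a. a < k \<Longrightarrow> (\<Sum>b<n. \<Sum>c<n. w a b c) = \<alpha>"
    and deg2: "\<And>b. b < n \<Longrightarrow> (\<Sum>a<k. \<Sum>c<n. w a b c) = \<beta>"
    and deg3: "\<And>c. c < n \<Longrightarrow> (\<Sum>a<k. \<Sum>b<n. w a b c) = \<gamma>"
    and g_less: "\<And>a b c. a < k \<Longrightarrow> b < n \<Longrightarrow> c < n \<Longrightarrow> g a b c < s"
    and meet: "\<And>a b c a' b' c'. a < k \<Longrightarrow> b < n \<Longrightarrow> c < n \<Longrightarrow> a' < k \<Longrightarrow> b' < n \<Longrightarrow> c' < n \<Longrightarrow>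
      w a b c > 0 \<Longrightarrow> w a' b' c' > 0 \<Longrightarrow> g a b c = g a' b' c' \<Longrightarrow> a = a' \<or> b = b' \<or> c = c'"
  shows "bm [k, n, n] \<le> s"
proof -
  \<comment> \<open>The shifts by \<open>k\<close> and \<open>k + n\<close> make the sides disjoint
    intervals of naturals, so that a triple can be recovered from its edge.\<close>
  define E where "E = (\<lambda>(a, b, c). {a, k + b, k + n + c})"
  define W where "W = (\<lambda>(a, b, c). w a b c)"
  define Box where "Box = {..<k} \<times> {..<n} \<times> {..<n}"
  \<comment> \<open>Zero-weight triples must not become edges, because \<open>meet\<close> says
    nothing about them.\<close>
  define T where "T = {t \<in> Box. W t > 0}"
  define V where "V = [{..<k}, {k..<k + n}, {k + n..<k + n + n}]"
  define f where "f e = real (W (inv_into Box E e))" for e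
  have finBox: "finite Box"
    by (simp add: Box_def)
  have TBox: "T \<subseteq> Box"
    by (auto simp: T_def)
  have inj: "inj_on E Box"
  proof (rule inj_onI)
    fix x y assume xy: "x \<in> Box" "y \<in> Box" "E x = E y"
    obtain a b c a' b' c' where eqs: "x = (a, b, c)" "y = (a', b', c')"
      by (metis prod_cases3)
    have less: "a < k" "b < n" "c < n" "a' < k" "b' < n" "c' < n"
      using xy eqs by (auto simp: Box_def)
    have eq: "{a, k + b, k + n + c} = {a', k + b', k + n + c'}"
      using xy(3) by (simp add: E_def eqs)
    have "a \<in> {a', k + b', k + n + c'}" "k + b \<in> {a', k + b', k + n + c'}"
      "k + n + c \<in> {a', k + b', k + n + c'}"
      unfolding eq[symmetric] by auto
    then show "x = y"
      using less eqs by auto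
  qed
  have fE: "f (E t) = real (W t)" if "t \<in> Box" for t
    using inj that by (simp add: f_def)
  \<comment> \<open>Triples outside \<open>T\<close> contribute zero, so the sum extends to the
    whole box, where \<open>deg1\<close>, \<open>deg2\<close> and \<open>deg3\<close> apply.\<close>
  have fdeg_eq: "fdeg (E ` T) f v =
      real (\<Sum>a<k. \<Sum>b<n. \<Sum>c<n. if v \<in> E (a, b, c) then w a b c else 0)" for v
  proof -
    have "fdeg (E ` T) f v = sum f (E ` {t \<in> T. v \<in> E t})"
      unfolding fdeg_def by (rule sum.cong) auto
    also have "\<dots> = (\<Sum>t | t \<in> T \<and> v \<in> E t. f (E t))"
      using inj by (subst sum.reindex) (auto simp: T_def inj_on_def)
    also have "\<dots> = (\<Sum>t | t \<in> T \<and> v \<in> E t. real (W t))"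
      using TBox by (intro sum.cong) (auto simp: fE)
    also have "\<dots> = (\<Sum>t\<in>Box. real (if v \<in> E t then W t else 0))"
      using finBox by (intro sum.mono_neutral_cong_left) (auto simp: T_def)
    also have "\<dots> = real (\<Sum>a<k. \<Sum>b<n. \<Sum>c<n. if v \<in> E (a, b, c) then w a b c else 0)"
      unfolding Box_def
      by (simp add: sum.cartesian_product W_def case_prod_unfold cong: if_cong flip: of_nat_sum)
    finally show ?thesis .
  qed
  have deg_a: "fdeg (E ` T) f v = \<alpha>" if "v < k" for v
  proof -
    have "(\<Sum>a<k. \<Sum>b<n. \<Sum>c<n. if v \<in> E (a, b, c) then w a b c else 0)
        = (\<Sum>a<k. if a = v then \<Sum>b<n. \<Sum>c<n. w a b c else 0)"
      using that by (intro sum.cong) (auto simp: E_def)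
    then show ?thesis
      using that by (simp add: fdeg_eq deg1)
  qed
  have deg_b: "fdeg (E ` T) f (k + v) = \<beta>" if "v < n" for v
  proof -
    have "(\<Sum>a<k. \<Sum>b<n. \<Sum>c<n. if k + v \<in> E (a, b, c) then w a b c else 0)
        = (\<Sum>a<k. \<Sum>b<n. if b = v then \<Sum>c<n. w a b c else 0)"
      using that by (intro sum.cong refl) (auto simp: E_def)
    then show ?thesis
      using that by (simp add: fdeg_eq deg2)
  qed
  have deg_c: "fdeg (E ` T) f (k + n + v) = \<gamma>" if "v < n" for v
  proof -
    have "(\<Sum>a<k. \<Sum>b<n. \<Sum>c<n. if k + n + v \<in> E (a, b, c) then w a b c else 0)
        = (\<Sum>a<k. \<Sum>b<n. \<Sum>c<n. if c = v then w a b c else 0)"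
      using that by (intro sum.cong refl) (auto simp: E_def)
    then show ?thesis
      using that by (simp add: fdeg_eq deg3)
  qed
  have balanced: "balanced V (E ` T) f"
  proof -
    have "fdeg (E ` T) f u = \<beta>" if "u \<in> {k..<k + n}" for u
      using deg_b[of "u - k"] that by auto
    moreover have "fdeg (E ` T) f u = \<gamma>" if "u \<in> {k + n..<k + n + n}" for u
      using deg_c[of "u - (k + n)"] that by auto
    ultimately show ?thesis
      using deg_a by (auto simp: balanced_def V_def)
  qed
  have partite: "partite V (E ` T)"
  proof -
    have "card (E t \<inter> X) = 1 \<and> E t \<subseteq> \<Union> (set V)" if "t \<in> T" "X \<in> set V" for t X
    proof -
      obtain a b c where t: "t = (a, b, c)"
        by (metis prod_cases3)
      have less: "a < k" "b < n" "c < n"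
        using that(1) TBox t by (auto simp: Box_def)
      have "E t \<inter> {..<k} = {a}" "E t \<inter> {k..<k + n} = {k + b}"
        "E t \<inter> {k + n..<k + n + n} = {k + n + c}"
        using less by (auto simp: E_def t)
      then show ?thesis
        using that(2) less by (auto simp: V_def E_def t)
    qed
    moreover have "\<forall>i<length V. \<forall>j<length V. i \<noteq> j \<longrightarrow> disjnt (V ! i) (V ! j)"
      by (auto simp: V_def disjnt_def less_Suc_eq nth_Cons')
    moreover have "{..<k} \<in> set V" "\<forall>X\<in>set V. finite X"
      by (auto simp: V_def)
    moreover have "finite (E ` T)"
      using finBox TBox finite_subset by blast
    ultimately show ?thesis
      unfolding partite_def by blast
  qed
  have nonzero: "\<exists>e\<in>E ` T. f e \<noteq> 0"
  proof (rule ccontr)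
    assume "\<not> ?thesis"
    \<comment> \<open>Vertex 0 lies in the first side, where every degree is the positive number
      \<open>\<alpha>\<close>.\<close>
    then have "fdeg (E ` T) f 0 = 0"
      by (auto simp: fdeg_def intro: sum.neutral)
    then show False
      using deg_a[of 0] \<open>k > 0\<close> \<open>\<alpha> > 0\<close> by simp
  qed
  have "fractionally_balanced [k, n, n] (E ` T)"
    unfolding fractionally_balanced_def
    using partite balanced nonzero by (intro exI[of _ V] conjI exI[of _ f]) (auto simp: V_def f_def)
  moreover have "card M \<le> s" if M: "M \<subseteq> E ` T" "matching M" for M
  proof -
    obtain S where S: "S \<subseteq> T" "M = E ` S"
      using M(1) by (meson subset_imageE)
    define G where "G = (\<lambda>(a, b, c). g a b c)"
    have "inj_on G S"
    proof (rule inj_onI)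
      fix x y assume xy: "x \<in> S" "y \<in> S" "G x = G y"
      obtain a b c a' b' c' where eqs: "x = (a, b, c)" "y = (a', b', c')"
        by (metis prod_cases3)
      have "a = a' \<or> b = b' \<or> c = c'"
        using xy S(1) by (intro meet) (auto simp: eqs T_def Box_def W_def G_def)
      then have "\<not> disjnt (E x) (E y)"
        by (auto simp: eqs E_def disjnt_def)
      then have "E x = E y"
        using M(2) xy S(2) by (auto simp: matching_def pairwise_def)
      then show "x = y"
        using inj xy S(1) TBox by (meson inj_onD subsetD)
    qed
    moreover have "G ` S \<subseteq> {..<s}"
      using S(1) g_less by (auto simp: T_def Box_def G_def)
    ultimately have "card S \<le> s"
      using card_inj_on_le[of G S "{..<s}"] by simp
    moreover have "card M \<le> card S"
      using S TBox finBox by (metis card_image_le finite_subset)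
    ultimately show ?thesis
      by simp
  qed
  ultimately show ?thesis
    by (rule bm_le_if_fractionally_balanced)
qed

lemma bm_le_first_side:
  assumes "k > 0" "n > 0"
  shows "bm [k, n, n] \<le> k"
  using assms
  by (intro bm_three_sides_le[where w = "\<lambda>_ _ _. 1" and g = "\<lambda>a _ _. a"]) simp_all

section \<open>The block weighting and its matchings\<close>

definition partner :: "nat \<Rightarrow> nat" where
  "partner b = (if even b then b + 1 else b - 1)"

lemma partner_partner: "partner (partner b) = b"
  by (auto simp: partner_def)

lemma partner_div_2: "partner b div 2 = b div 2"
  by (auto simp: partner_def elim!: evenE oddE)

lemma partner_less_iff: "partner b < 2 * m \<longleftrightarrow> b < 2 * m"
  by (auto simp: partner_def elim!: evenE oddE)

lemma div_2_eq_iff: "b div 2 = c div 2 \<longleftrightarrow> c = b \<or> c = partner b"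
  by (auto simp: partner_def elim!: evenE oddE)

text \<open>Block \<open>i\<close> is \<open>{2 * i, 2 * i + 1}\<close> in both of the last two
  sides. First-side indices below \<open>d\<close> are the group vertices, and \<open>d + i\<close>
  is the vertex of block \<open>i\<close>. The last branch is the spare pair: below an odd
  \<open>n\<close> with \<open>n div 2 = d * q\<close>, only index \<open>2 * (d * q)\<close>
  reaches it.\<close>

definition block_weight :: "nat \<Rightarrow> nat \<Rightarrow> nat \<Rightarrow> nat \<Rightarrow> nat \<Rightarrow> nat" where
  "block_weight d q a b c =
    (if b < 2 * (d * q)
     then (if c = b \<and> a = b div 2 div q then d else 0) +
          (if c = partner b \<and> a = d + b div 2 then d * q else 0)
     else if c = b then 1 else 0)"

text \<open>\<open>partner\<close> is an involution that preserves blocks. The symmetry carries the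
  degrees of the second side over to the third.\<close>

lemma block_weight_commute: "block_weight d q a b c = block_weight d q a c b"
proof -
  have "c = partner b \<longleftrightarrow> b = partner c"
    by (metis partner_partner)
  then show ?thesis
    by (auto simp: block_weight_def partner_div_2 partner_less_iff)
qed

text \<open>For distinct \<open>b\<close> and \<open>b'\<close> in a block, two parallel edges share
  the group vertex, two crossing edges share the block vertex, and a parallel and a crossing edge
  share their third vertex.\<close>

lemma block_weight_meet:
  assumes "block_weight d q a b c > 0" "block_weight d q a' b' c' > 0"
    and "b div 2 = b' div 2" "b < n" "b' < n" "n div 2 = d * q"
  shows "a = a' \<or> b = b' \<or> c = c'"
proof (cases "b' = b")
  case False
  then have b': "b' = partner b"
    using assms(3) by (simp add: div_2_eq_iff)
  \<comment> \<open>As \<open>b\<close> and its partner are both below \<open>n\<close>, neither is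
    the spare vertex.\<close>
  have "b < 2 * (d * q)"
  proof -
    have "b div 2 < n div 2"
      using assms(4,5) by (auto simp: b' partner_def split: if_splits elim!: evenE oddE)
    then show ?thesis
      using assms(6) by simp
  qed
  then show ?thesis
    using assms(1,2) by (auto simp: block_weight_def b' partner_partner partner_div_2
        partner_less_iff split: if_splits)
qed simp

lemma card_div_eq:
  fixes q N :: nat
  assumes "q > 0" "(i + 1) * q \<le> N"
  shows "card {b. b < N \<and> b div q = i} = q"
proof -
  have "{b. b < N \<and> b div q = i} = {i * q..<(i + 1) * q}"
    using assms by (auto simp: div_nat_eqI less_mult_imp_div_less mult.commute
        dividend_less_times_div algebra_simps intro: div_nat_eqI)
  then show ?thesis
    by simp
qed

text \<open>A group vertex has \<open>2 * q\<close> edges of weight \<open>d\<close>, a block vertex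
  two of weight \<open>d * q\<close>; with the spare edge for odd \<open>n\<close>, both reach
  degree \<open>n\<close>. On the other sides the degree is \<open>d + d * q\<close>, at a spare
  vertex as one unit from each first-side vertex.\<close>

lemma bm_le_blocks:
  fixes d q n :: nat
  assumes "d > 0" and n: "n div 2 = d * q" and "n > 0"
  shows "bm [d + d * q, n, n] \<le> (n + 1) div 2"
proof -
  define m where "m = d * q"
  define r where "r = n mod 2"
  have nm: "n = 2 * m + r" and r: "r = 0 \<or> r = 1"
    unfolding m_def r_def n[symmetric] by auto
  let ?w = "block_weight d q"
  have sum_c: "(\<Sum>c<n. ?w a b c) =
      (if b < 2 * m then (if a = b div 2 div q then d else 0) + (if a = d + b div 2 then m else 0)
       else 1)" if "b < n" for a b
  proof (cases "b < 2 * m")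
    case True
    then have pb: "partner b < n"
      using partner_less_iff[of b m] nm by simp
    have "(\<Sum>c<n. ?w a b c) =
        (\<Sum>c<n. (if c = b then if a = b div 2 div q then d else 0 else 0) +
              (if c = partner b then if a = d + b div 2 then m else 0 else 0))"
      using True by (intro sum.cong) (auto simp: block_weight_def m_def)
    also have "\<dots> = (if a = b div 2 div q then d else 0) + (if a = d + b div 2 then m else 0)"
      using pb that by (simp add: sum.distrib)
    finally show ?thesis
      using True by simp
  next
    case False
    then show ?thesis
      using that by (simp add: block_weight_def m_def)
  qed
  have deg1: "(\<Sum>b<n. \<Sum>c<n. ?w a b c) = n" if a: "a < d + m" for a
  proof -
    have "(\<Sum>b<n. \<Sum>c<n. ?w a b c) =
        (\<Sum>b<2 * m. (if b div (2 * q) = a then d else 0) + (if b div 2 + d = a then m else 0)) + r"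
    proof -
      have "(\<Sum>b<n. \<Sum>c<n. ?w a b c) = (\<Sum>b<2 * m. \<Sum>c<n. ?w a b c) + r"
      proof (cases "r = 0")
        case False
        then have "r = 1" "n = Suc (2 * m)"
          using r nm by auto
        then show ?thesis
          using sum_c[of "2 * m" a] by simp
      qed (use nm in simp)
      moreover have "(\<Sum>b<2 * m. \<Sum>c<n. ?w a b c) =
          (\<Sum>b<2 * m. (if b div (2 * q) = a then d else 0) + (if b div 2 + d = a then m else 0))"
      proof (rule sum.cong)
        fix b assume "b \<in> {..<2 * m}"
        then have "b < 2 * m" "b < n"
          using nm by auto
        then show "(\<Sum>c<n. ?w a b c) =
            (if b div (2 * q) = a then d else 0) + (if b div 2 + d = a then m else 0)"
          by (auto simp: sum_c div_mult2_eq)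
      qed simp
      ultimately show ?thesis
        by simp
    qed
    also have "\<dots> = card {b. b < 2 * m \<and> b div (2 * q) = a} * d +
        card {b. b < 2 * m \<and> b div 2 + d = a} * m + r"
      by (simp add: sum.distrib sum.If_cases Int_def)
    also have "\<dots> = n"
    \<comment> \<open>Without blocks both counts vanish. This is exactly the case
      \<open>q = 0\<close>, where the fibres of division by \<open>2 * q\<close> cannot be counted
      as below.\<close>
    proof (cases "m = 0")
      case True
      then show ?thesis
        by (simp add: nm)
    next
      case False
      then have q: "q > 0"
        by (simp add: m_def)
      show ?thesis
      proof (cases "a < d")
        case True
        have "(a + 1) * (2 * q) \<le> d * (2 * q)"
          using True by (intro mult_right_mono) auto
        then have "card {b. b < 2 * m \<and> b div (2 * q) = a} = 2 * q"
          using q by (intro card_div_eq) (auto simp: m_def algebra_simps)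
        moreover have "{b. b < 2 * m \<and> b div 2 + d = a} = {}"
          using True by auto
        ultimately show ?thesis
          by (simp add: nm m_def)
      next
        case False
        have "{b. b < 2 * m \<and> b div (2 * q) = a} = {}"
          using False by (auto simp: m_def not_less)
            (metis div_less_iff_less_mult mult.commute mult.left_commute mult_pos_pos not_less pos2 q)
        moreover have "{b. b < 2 * m \<and> b div 2 + d = a} = {b. b < 2 * m \<and> b div 2 = a - d}"
          using False by auto
        moreover have "card {b. b < 2 * m \<and> b div 2 = a - d} = 2"
          using False a by (intro card_div_eq) auto
        ultimately show ?thesis
          by (simp add: nm)
      qed
    qed
    finally show ?thesis .
  qed
  have deg2: "(\<Sum>a<d + m. \<Sum>c<n. ?w a b c) = d + m" if b: "b < n" for b
  proof (cases "b < 2 * m")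
    case True
    then have "b div 2 div q < d" "b div 2 < m"
      by (auto simp: m_def less_mult_imp_div_less)
    then show ?thesis
      using True b by (simp add: sum_c sum.distrib)
  next
    case False
    then show ?thesis
      using b by (simp add: sum_c)
  qed
  have deg3: "(\<Sum>a<d + m. \<Sum>b<n. ?w a b c) = d + m" if "c < n" for c
    using deg2[OF that] by (subst block_weight_commute)
  show ?thesis
    unfolding m_def[symmetric]
  \<comment> \<open>Edges are labelled by the block of their second vertex; for odd \<open>n\<close>
    the spare vertex forms a further block with label \<open>m\<close>.\<close>
  proof (rule bm_three_sides_le[where w = ?w and g = "\<lambda>a b c. b div 2"])
    show "b div 2 < (n + 1) div 2" if "b < n" for b
      using that by linarith
  qed (use assms deg1 deg2 deg3 block_weight_meet[of d q _ _ _ _ _ _ n] in auto)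
qed

theorem theorem6p2:
  fixes k n :: nat and m :: int
  assumes "k > 0" and "n > 0"
    and "m = \<lfloor>real n / 2\<rfloor>"
    and "(int k - m) dvd m"
  shows "int (bm [k, n, n]) \<le> min (int k) \<lceil>real n / 2\<rceil>"
proof -
  have m: "m = int (n div 2)"
    using assms(3) by (simp add: floor_divide_of_nat_eq[of n 2, simplified])
  have ceil: "\<lceil>real n / 2\<rceil> = int ((n + 1) div 2)"
    by (rule ceiling_unique) (cases "even n"; auto elim!: evenE oddE simp: field_simps)+
  have first: "bm [k, n, n] \<le> k"
    using assms(1,2) by (rule bm_le_first_side)
  have "bm [k, n, n] \<le> (n + 1) div 2"
  \<comment> \<open>The case settled by the first side includes all \<open>k\<close> with
    \<open>k - m\<close> zero or negative, so the truncated subtraction defining \<open>d\<close>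
    below is exact.\<close>
  proof (cases "k \<le> (n + 1) div 2")
    case False
    define d where "d = k - n div 2"
    have d: "d > 0" "k = d + n div 2"
      using False by (auto simp: d_def)
    then have "int d dvd int (n div 2)"
      using assms(4) m by simp
    then obtain q where "n div 2 = d * q"
      unfolding int_dvd_int_iff by (elim dvdE)
    then show ?thesis
      using bm_le_blocks[of d n q] d assms(2) by simp
  qed (use first in simp)
  with first show ?thesis
    by (simp add: ceil)
qed

end
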